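(* Let $X$ be a hereditarily Lindelöf, $T_{1}$, regular, strong Choquet space. Then $\mathsf{OGA}(X)$ holds. Furthermore, for every open partition $[X]^2=K_0\cup K_1$ (with $K_0$ open), if $X$ is not $\sigma$-$K_1$-homogeneous, then $X$ has a $K_0$-homogeneous subset of cardinality continuum without isolated points.
   Context: $[X]^2$ is the collection of two-element subsets of $X$. A set $K\subseteq [X]^2$ is open if $\{\langle x,y\rangle\in X^2:\{x,y\}\in K\}$ is open in the product space $X^2$. An open partition is a partition $[X]^2=K_0\cup K_1$ with $K_0$ open. A set $Y\subseteq X$ is $K_i$-homogeneous if $[Y]^2\subseteq K_i$, and $\sigma$-$K_i$-homogeneous if it can be covered by countably many $K_i$-homogeneous sets. $\mathsf{OGA}(X)$ is the assertion that for every open partition $[X]^{2}=K_{0}\cup K_{1}$, either there is an uncountable $K_{0}$-homogeneous subset of $X$ or $X$ is the union of countably many $K_{1}$-homogeneous sets. A space is hereditarily Lindelöf if every subspace is Lindelöf. The strong Choquet game on $X$: at round $n$, Player I plays a pair $\langle x_n,U_n\rangle$ with $U_n\subseteq X$ open and $x_n\in U_n$ (and $U_n\subseteq V_{n-1}$ if $n\geq 1$); Player II answers with an open set $V_n$ with $x_n\in V_n\subseteq U_n$. Player II wins the run if $\bigcap_{n}U_n=\bigcap_n V_n\neq\emptyset$. A nonempty space $X$ is strong Choquet if Player II has a winning strategy in this game. *)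

theory Defs
  imports "HOL-Analysis.Analysis" "HOL-Library.Ramsey" "HOL-Library.Equipollence"
begin

definition open_pairs :: "'a topology \<Rightarrow> 'a set set \<Rightarrow> bool" where
  "open_pairs X K \<longleftrightarrow>
     K \<subseteq> [topspace X]\<^bsup>2\<^esup> \<and>
     openin (prod_topology X X) {(x, y) \<in> topspace X \<times> topspace X. {x, y} \<in> K}"

definition open_partition :: "'a topology \<Rightarrow> 'a set set \<Rightarrow> 'a set set \<Rightarrow> bool" where
  "open_partition X K0 K1 \<longleftrightarrow>
     K0 \<union> K1 = [topspace X]\<^bsup>2\<^esup> \<and> K0 \<inter> K1 = {} \<and> open_pairs X K0"

definition homogeneous :: "'a topology \<Rightarrow> 'a set set \<Rightarrow> 'a set \<Rightarrow> bool" where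
  "homogeneous X K Y \<longleftrightarrow> Y \<subseteq> topspace X \<and> [Y]\<^bsup>2\<^esup> \<subseteq> K"

definition sigma_homogeneous :: "'a topology \<Rightarrow> 'a set set \<Rightarrow> 'a set \<Rightarrow> bool" where
  "sigma_homogeneous X K Y \<longleftrightarrow>
     (\<exists>\<H>. countable \<H> \<and> (\<forall>H\<in>\<H>. homogeneous X K H) \<and> Y \<subseteq> \<Union>\<H>)"

definition OGA :: "'a topology \<Rightarrow> bool" where
  "OGA X \<longleftrightarrow>
     (\<forall>K0 K1. open_partition X K0 K1 \<longrightarrow>
        (\<exists>Y. homogeneous X K0 Y \<and> uncountable Y) \<or>
        (\<exists>\<H>. countable \<H> \<and> (\<forall>H\<in>\<H>. homogeneous X K1 H) \<and> \<Union>\<H> = topspace X))"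

definition choquet_legal_I ::
    "'a topology \<Rightarrow> (nat \<Rightarrow> 'a) \<Rightarrow> (nat \<Rightarrow> 'a set) \<Rightarrow> (nat \<Rightarrow> 'a set) \<Rightarrow> nat \<Rightarrow> bool" where
  "choquet_legal_I X x U V n \<longleftrightarrow>
     openin X (U n) \<and> x n \<in> U n \<and> (n \<ge> 1 \<longrightarrow> U n \<subseteq> V (n - 1))"

definition choquet_legal_II ::
    "'a topology \<Rightarrow> (nat \<Rightarrow> 'a) \<Rightarrow> (nat \<Rightarrow> 'a set) \<Rightarrow> (nat \<Rightarrow> 'a set) \<Rightarrow> nat \<Rightarrow> bool" where
  "choquet_legal_II X x U V n \<longleftrightarrow> openin X (V n) \<and> x n \<in> V n \<and> V n \<subseteq> U n"

text \<open>A strategy for Player II maps the list of Player I's moves so far, the current one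
  included, to an answer; Player II's own earlier moves are determined by this list.\<close>

definition choquet_reply ::
    "(('a \<times> 'a set) list \<Rightarrow> 'a set) \<Rightarrow> (nat \<Rightarrow> 'a) \<Rightarrow> (nat \<Rightarrow> 'a set) \<Rightarrow> nat \<Rightarrow> 'a set" where
  "choquet_reply \<sigma> x U n = \<sigma> (map (\<lambda>i. (x i, U i)) [0..<Suc n])"

text \<open>Legality of Player II's answers is required after every finite legal play: were it required
  only in infinite plays, Player II could win by leaving Player I without a legal move.\<close>

definition choquet_winning_II ::
    "'a topology \<Rightarrow> (('a \<times> 'a set) list \<Rightarrow> 'a set) \<Rightarrow> bool" where
  "choquet_winning_II X \<sigma> \<longleftrightarrow>
     (\<forall>x U. let V = choquet_reply \<sigma> x U in
        (\<forall>n. (\<forall>i\<le>n. choquet_legal_I X x U V i) \<longrightarrow> choquet_legal_II X x U V n) \<and>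
        ((\<forall>n. choquet_legal_I X x U V n) \<longrightarrow>
           (\<Inter>n. U n) = (\<Inter>n. V n) \<and> (\<Inter>n. V n) \<noteq> {}))"

definition strong_choquet :: "'a topology \<Rightarrow> bool" where
  "strong_choquet X \<longleftrightarrow> topspace X \<noteq> {} \<and> (\<exists>\<sigma>. choquet_winning_II X \<sigma>)"

definition no_isolated_points :: "'a topology \<Rightarrow> bool" where
  "no_isolated_points X \<longleftrightarrow> (\<forall>x\<in>topspace X. \<not> openin X {x})"

end

theory Submission
  imports Defs
begin

text \<open>Cut away from \<open>X\<close> every open set that is \<open>\<sigma>\<close>-\<open>K1\<close>-homogeneous. Hereditary Lindelofness
  reduces the union of these sets to a countable union, so what is cut away is itself
  \<open>\<sigma>\<close>-\<open>K1\<close>-homogeneous. If \<open>X\<close> is not, a nonempty remainder \<open>Z\<close> is left, and each open set meeting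
  \<open>Z\<close> contains a pair of points of \<open>Z\<close> that lies in \<open>K0\<close> (\<open>sigma_homogeneous_kernel\<close>). Since \<open>K0\<close> is
  open, the two points can be separated by open sets all of whose cross pairs are in \<open>K0\<close>.

  Repeating this splitting, with Player II's winning strategy shrinking the open sets after each
  step, gives a binary tree of plays of the strong Choquet game (\<open>Choquet_Cantor_scheme\<close>). The
  strategy provides a point in the intersection along each of the continuum many branches, and
  points from different branches were separated where the branches parted, so their pair is in
  \<open>K0\<close>. The resulting \<open>K0\<close>-homogeneous set of size continuum may have isolated points, because the
  open sets along a branch need not form a neighbourhood base. Deleting the points with a
  countable relative neighbourhood cures this: hereditary Lindelofness makes this a deletion
  of only countably many points (\<open>Lindelof_condensation_points\<close>).\<close>

section \<open>Countable subfamilies and deletion of countable sets\<close>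

lemma hereditarily_Lindelof_countable_subfamily:
  assumes "hereditarily Lindelof_space X" and "\<And>U. U \<in> \<U> \<Longrightarrow> openin X U"
  obtains \<V> where "countable \<V>" "\<V> \<subseteq> \<U>" "\<Union>\<V> = \<Union>\<U>"
proof -
  have sub: "\<Union>\<U> \<subseteq> topspace X"
    using assms(2) openin_subset by blast
  then have "Lindelof_space (subtopology X (\<Union>\<U>))"
    using assms(1) by (simp add: hereditarily)
  then have "\<exists>\<V>. countable \<V> \<and> \<V> \<subseteq> \<U> \<and> \<Union>\<U> \<subseteq> \<Union>\<V>"
    using assms(2) Lindelof_space_subtopology_subset[OF sub] by blast
  then obtain \<V> where \<V>: "countable \<V>" "\<V> \<subseteq> \<U>" "\<Union>\<U> \<subseteq> \<Union>\<V>"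
    by (elim exE conjE)
  moreover have "\<Union>\<V> \<subseteq> \<Union>\<U>"
    using \<V>(2) by (rule Union_mono)
  ultimately show thesis
    by (intro that[of \<V>] equalityI)
qed

lemma uncountable_Diff_countable_eqpoll:
  assumes "uncountable Y" "countable C"
  shows "Y - C \<approx> Y"
proof -
  have "infinite (Y - C)"
    using assms uncountable_minus_countable uncountable_infinite by blast
  \<comment> \<open>A countably infinite \<open>D\<close> outside \<open>C\<close> absorbs the part of \<open>C\<close> inside \<open>Y\<close>.\<close>
  then obtain D where D: "D \<subseteq> Y - C" "countable D" "infinite D"
    using infinite_countable_subset' by blast
  have "D \<approx> D \<union> (C \<inter> Y)"
    by (meson D assms(2) countable_Int1 countable_Un countable_infiniteE' eqpoll_def
        eqpoll_trans eqpoll_sym finite_Un bij_betw_from_nat_into)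
  then have "(Y - C - D) \<union> D \<approx> (Y - C - D) \<union> (D \<union> (C \<inter> Y))"
    by (intro Un_eqpoll_cong) (auto simp: disjnt_def)
  moreover have "(Y - C - D) \<union> D = Y - C" "(Y - C - D) \<union> (D \<union> (C \<inter> Y)) = Y"
    using D by auto
  ultimately show ?thesis
    by simp
qed

lemma eqpoll_reals_imp_uncountable:
  "Y \<approx> (UNIV :: real set) \<Longrightarrow> uncountable Y"
  by (metis countable_eqpoll eqpoll_sym uncountable_UNIV_real)

section \<open>Homogeneous sets and the kernel of a partition\<close>

lemma homogeneous_subset:
  "homogeneous X K Y \<Longrightarrow> Y' \<subseteq> Y \<Longrightarrow> homogeneous X K Y'"
  unfolding homogeneous_def by (meson nsets_mono order_trans)

lemma sigma_homogeneous_countable_Union: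
  assumes "countable \<V>" "\<And>V. V \<in> \<V> \<Longrightarrow> sigma_homogeneous X K V"
  shows "sigma_homogeneous X K (\<Union>\<V>)"
proof -
  have "\<forall>V\<in>\<V>. \<exists>\<H>. countable \<H> \<and> (\<forall>H\<in>\<H>. homogeneous X K H) \<and> V \<subseteq> \<Union>\<H>"
    using assms(2) by (simp add: sigma_homogeneous_def)
  then obtain F where
    F: "\<forall>V\<in>\<V>. countable (F V) \<and> (\<forall>H\<in>F V. homogeneous X K H) \<and> V \<subseteq> \<Union>(F V)"
    by metis
  show ?thesis
    unfolding sigma_homogeneous_def
  proof (intro exI conjI)
    show "countable (\<Union>V\<in>\<V>. F V)"
      using assms(1) F by blast
    show "\<forall>H\<in>(\<Union>V\<in>\<V>. F V). homogeneous X K H"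
      using F by auto
    show "\<Union>\<V> \<subseteq> \<Union>(\<Union>V\<in>\<V>. F V)"
    proof (rule Union_least)
      fix V assume "V \<in> \<V>"
      then have "V \<subseteq> \<Union>(F V)" "F V \<subseteq> (\<Union>V\<in>\<V>. F V)"
        using F by auto
      then show "V \<subseteq> \<Union>(\<Union>V\<in>\<V>. F V)"
        by (meson Union_mono order_trans)
    qed
  qed
qed

lemma sigma_homogeneous_subset:
  "sigma_homogeneous X K Y \<Longrightarrow> Y' \<subseteq> Y \<Longrightarrow> sigma_homogeneous X K Y'"
  unfolding sigma_homogeneous_def by (meson order_trans)

lemma homogeneous_imp_sigma_homogeneous:
  "homogeneous X K Y \<Longrightarrow> sigma_homogeneous X K Y"
  unfolding sigma_homogeneous_def by (intro exI[of _ "{Y}"]) auto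

lemma sigma_homogeneous_Un:
  assumes "sigma_homogeneous X K Y" "sigma_homogeneous X K Y'"
  shows "sigma_homogeneous X K (Y \<union> Y')"
  using sigma_homogeneous_countable_Union[of "{Y, Y'}"] assms by auto

text \<open>The kernel is the complement of the largest open \<open>\<sigma>\<close>-\<open>K\<close>-homogeneous set \<open>W\<close>. If an open \<open>V\<close>
  met it in a nonempty \<open>K\<close>-homogeneous set, then \<open>V\<close> would be \<open>\<sigma>\<close>-\<open>K\<close>-homogeneous, as it is covered by
  that set and \<open>W\<close>; hence \<open>V \<subseteq> W\<close>, a contradiction.\<close>

lemma sigma_homogeneous_kernel:
  assumes "hereditarily Lindelof_space X" and "\<not> sigma_homogeneous X K (topspace X)"
  obtains Z where "Z \<subseteq> topspace X" "Z \<noteq> {}"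
    "\<And>V. openin X V \<Longrightarrow> V \<inter> Z \<noteq> {} \<Longrightarrow> \<not> homogeneous X K (V \<inter> Z)"
proof -
  define \<U> where "\<U> = {U. openin X U \<and> sigma_homogeneous X K U}"
  define W where "W = \<Union>\<U>"
  have "openin X U" if "U \<in> \<U>" for U
    using that by (simp add: \<U>_def)
  then obtain \<V> where "countable \<V>" "\<V> \<subseteq> \<U>" "\<Union>\<V> = W"
    unfolding W_def by (metis hereditarily_Lindelof_countable_subfamily[OF assms(1)])
  then have W: "sigma_homogeneous X K W"
    using sigma_homogeneous_countable_Union[of \<V> X K] by (auto simp: \<U>_def)
  show thesis
  proof (rule that[of "topspace X - W"])
    show "topspace X - W \<subseteq> topspace X"
      by (rule Diff_subset)
    show "topspace X - W \<noteq> {}"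
      using W assms(2) sigma_homogeneous_subset by blast
    fix V assume V: "openin X V" "V \<inter> (topspace X - W) \<noteq> {}"
    show "\<not> homogeneous X K (V \<inter> (topspace X - W))"
    proof
      assume "homogeneous X K (V \<inter> (topspace X - W))"
      then have "sigma_homogeneous X K (V \<inter> (topspace X - W) \<union> W)"
        by (simp add: W homogeneous_imp_sigma_homogeneous sigma_homogeneous_Un)
      then have "sigma_homogeneous X K V"
        by (rule sigma_homogeneous_subset) (use V(1) openin_subset in blast)
      then have "V \<in> \<U>"
        using V(1) by (simp add: \<U>_def)
      then show False
        using V(2) by (auto simp: W_def)
    qed
  qed
qed

section \<open>The tree of plays\<close>

lemma open_pairs_separate:
  assumes "open_pairs X K" "{a, b} \<in> K"
  obtains A B where "openin X A" "openin X B" "a \<in> A" "b \<in> B"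
    "\<And>p q. p \<in> A \<Longrightarrow> q \<in> B \<Longrightarrow> {p, q} \<in> K"
proof -
  let ?S = "{(x, y) \<in> topspace X \<times> topspace X. {x, y} \<in> K}"
  have S: "openin (prod_topology X X) ?S"
    using assms(1) unfolding open_pairs_def by (rule conjunct2)
  have "K \<subseteq> [topspace X]\<^bsup>2\<^esup>"
    using assms(1) unfolding open_pairs_def by (rule conjunct1)
  then have "{a, b} \<in> [topspace X]\<^bsup>2\<^esup>"
    using assms(2) by (rule subsetD)
  then have "(a, b) \<in> ?S"
    using assms(2) by simp
  then obtain A B where AB: "openin X A" "openin X B" "a \<in> A" "b \<in> B" "A \<times> B \<subseteq> ?S"
    using S unfolding openin_prod_topology_alt by meson
  have "{p, q} \<in> K" if "p \<in> A" "q \<in> B" for p q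
    using AB(5) that by auto
  then show thesis
    using that AB(1-4) by blast
qed

text \<open>One move of Player I at a node of the tree, for both successors: the Boolean selects the
  successor, and cross pairs of the two open sets are in \<open>K0\<close>.\<close>

lemma open_partition_split:
  assumes "open_partition X K0 K1" and "openin X V" and "Z \<subseteq> topspace X"
    and "\<not> homogeneous X K1 (V \<inter> Z)"
  shows "\<exists>m :: bool \<Rightarrow> 'a \<times> 'a set.
      (\<forall>i. fst (m i) \<in> Z \<and> fst (m i) \<in> snd (m i) \<and> openin X (snd (m i)) \<and> snd (m i) \<subseteq> V) \<and>
      (\<forall>i j p q. i \<noteq> j \<longrightarrow> p \<in> snd (m i) \<longrightarrow> q \<in> snd (m j) \<longrightarrow> {p, q} \<in> K0)"
proof -
  obtain e where e: "e \<in> [V \<inter> Z]\<^bsup>2\<^esup>" "e \<notin> K1"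
    using assms(3,4) unfolding homogeneous_def by blast
  then obtain a b where ab: "e = {a, b}" "a \<in> V \<inter> Z" "b \<in> V \<inter> Z"
    by (metis nsets2_E)
  have "[V \<inter> Z]\<^bsup>2\<^esup> \<subseteq> [topspace X]\<^bsup>2\<^esup>"
    using assms(3) by (intro nsets_mono) blast
  then have "e \<in> K0 \<union> K1"
    using e(1) assms(1) by (auto simp only: open_partition_def)
  then have "{a, b} \<in> K0"
    using e(2) ab(1) by simp
  moreover have "open_pairs X K0"
    using assms(1) by (simp add: open_partition_def)
  ultimately obtain A B where AB: "openin X A" "openin X B" "a \<in> A" "b \<in> B"
      "\<And>p q. p \<in> A \<Longrightarrow> q \<in> B \<Longrightarrow> {p, q} \<in> K0"
    by (metis open_pairs_separate)
  define m where "m i = (if i then (a, A \<inter> V) else (b, B \<inter> V))" for i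
  have "fst (m i) \<in> Z \<and> fst (m i) \<in> snd (m i) \<and> openin X (snd (m i)) \<and> snd (m i) \<subseteq> V" for i
    using ab AB(1-4) assms(2) by (simp add: m_def openin_Int)
  moreover have "{p, q} \<in> K0" if "i \<noteq> j" "p \<in> snd (m i)" "q \<in> snd (m j)" for i j p q
    using that AB(5)[of p q] AB(5)[of q p]
    by (cases i; cases j) (simp_all add: m_def insert_commute)
  ultimately show ?thesis
    by metis
qed

text \<open>The positions in the game against \<open>\<sigma>\<close> that are reached when Player I starts with \<open>m0\<close> and then
  answers each open set \<open>V\<close> of Player II by the move \<open>split V i\<close>, with the bits \<open>i\<close> read off from
  \<open>f\<close>.\<close>

primrec branch_position ::
    "(('a \<times> 'a set) list \<Rightarrow> 'a set) \<Rightarrow> ('a set \<Rightarrow> bool \<Rightarrow> 'a \<times> 'a set) \<Rightarrow> 'a \<times> 'a set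
      \<Rightarrow> (nat \<Rightarrow> bool) \<Rightarrow> nat \<Rightarrow> ('a \<times> 'a set) list" where
  "branch_position \<sigma> split m0 f 0 = [m0]"
| "branch_position \<sigma> split m0 f (Suc n) =
     branch_position \<sigma> split m0 f n @ [split (\<sigma> (branch_position \<sigma> split m0 f n)) (f n)]"

lemma branch_position_cong:
  "(\<And>i. i < n \<Longrightarrow> f i = g i) \<Longrightarrow>
     branch_position \<sigma> split m0 f n = branch_position \<sigma> split m0 g n"
  by (induction n) auto

lemma branch_position_eq_map_last:
  "branch_position \<sigma> split m0 f n =
     map (\<lambda>i. last (branch_position \<sigma> split m0 f i)) [0..<Suc n]"
proof (induction n)
  case (Suc n)
  have "branch_position \<sigma> split m0 f (Suc n) =
      branch_position \<sigma> split m0 f n @ [last (branch_position \<sigma> split m0 f (Suc n))]"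
    by simp
  also have "\<dots> = map (\<lambda>i. last (branch_position \<sigma> split m0 f i)) [0..<Suc n] @
      [last (branch_position \<sigma> split m0 f (Suc n))]"
    by (subst Suc.IH) (rule refl)
  also have "\<dots> = map (\<lambda>i. last (branch_position \<sigma> split m0 f i)) [0..<Suc (Suc n)]"
    by (simp del: branch_position.simps)
  finally show ?case .
qed simp

text \<open>Each branch of the tree is a play won by Player II, and \<open>y f\<close> is a common point of the open
  sets along the branch \<open>f\<close>. Player I plays points of \<open>Z\<close> to keep the construction going: Player II's
  answer contains the last point played, so it meets \<open>Z\<close> and can be split again. The points \<open>y f\<close>
  themselves may lie outside \<open>Z\<close>; their pairs are in \<open>K0\<close> because of the open sets they lie in.\<close>

lemma Choquet_Cantor_scheme:
  assumes part: "open_partition X K0 K1" and win: "choquet_winning_II X \<sigma>"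
    and Z: "Z \<subseteq> topspace X" "Z \<noteq> {}"
    and nonhom: "\<And>V. openin X V \<Longrightarrow> V \<inter> Z \<noteq> {} \<Longrightarrow> \<not> homogeneous X K1 (V \<inter> Z)"
  obtains y :: "(nat \<Rightarrow> bool) \<Rightarrow> 'a" where
    "range y \<subseteq> topspace X" "\<And>f g. f \<noteq> g \<Longrightarrow> {y f, y g} \<in> K0"
proof -
  have "\<forall>V. openin X V \<and> V \<inter> Z \<noteq> {} \<longrightarrow> (\<exists>m :: bool \<Rightarrow> 'a \<times> 'a set.
      (\<forall>i. fst (m i) \<in> Z \<and> fst (m i) \<in> snd (m i) \<and> openin X (snd (m i)) \<and> snd (m i) \<subseteq> V) \<and>
      (\<forall>i j p q. i \<noteq> j \<longrightarrow> p \<in> snd (m i) \<longrightarrow> q \<in> snd (m j) \<longrightarrow> {p, q} \<in> K0))"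
    using open_partition_split[OF part _ Z(1) nonhom] by simp
  then obtain split :: "'a set \<Rightarrow> bool \<Rightarrow> 'a \<times> 'a set" where
    split: "\<And>V i. openin X V \<Longrightarrow> V \<inter> Z \<noteq> {} \<Longrightarrow>
        fst (split V i) \<in> Z \<and> fst (split V i) \<in> snd (split V i) \<and>
        openin X (snd (split V i)) \<and> snd (split V i) \<subseteq> V"
    and split_K0: "\<And>V i j p q. openin X V \<Longrightarrow> V \<inter> Z \<noteq> {} \<Longrightarrow> i \<noteq> j \<Longrightarrow>
        p \<in> snd (split V i) \<Longrightarrow> q \<in> snd (split V j) \<Longrightarrow> {p, q} \<in> K0"
    by metis
  obtain z where z: "z \<in> Z"
    using Z(2) by blast
  define pos where "pos = branch_position \<sigma> split (z, topspace X)"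
  define x where "x f n = fst (last (pos f n))" for f n
  define U where "U f n = snd (last (pos f n))" for f n
  define V where "V f = choquet_reply \<sigma> (x f) (U f)" for f
  have V_eq: "V f n = \<sigma> (pos f n)" for f n
    unfolding V_def choquet_reply_def x_def U_def pos_def prod.collapse
    by (subst branch_position_eq_map_last) (rule refl)
  have last_Suc: "last (pos f (Suc n)) = split (V f n) (f n)" for f n
    by (simp add: V_eq) (simp add: pos_def)
  have reply: "choquet_legal_II X (x f) (U f) (V f) n"
    if "\<forall>i\<le>n. choquet_legal_I X (x f) (U f) (V f) i" for f n
    using win that unfolding choquet_winning_II_def Let_def V_def by blast
  have legal: "(\<forall>i\<le>n. choquet_legal_I X (x f) (U f) (V f) i) \<and> x f n \<in> Z" for f n
  proof (induction n)
    case 0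
    then show ?case
      using z Z(1) by (auto simp: choquet_legal_I_def x_def U_def pos_def)
  next
    case (Suc n)
    then have "openin X (V f n)" "V f n \<inter> Z \<noteq> {}"
      using reply[of n f] by (auto simp: choquet_legal_II_def)
    then have "choquet_legal_I X (x f) (U f) (V f) (Suc n) \<and> x f (Suc n) \<in> Z"
      using split[of "V f n" "f n"] by (simp add: choquet_legal_I_def x_def U_def last_Suc)
    with Suc show ?case
      by (auto simp: le_Suc_eq)
  qed
  have V: "openin X (V f n)" "V f n \<inter> Z \<noteq> {}" for f n
    using reply[of n f] legal[of n f] by (auto simp: choquet_legal_II_def)
  have "(\<Inter>n. U f n) = (\<Inter>n. V f n) \<and> (\<Inter>n. V f n) \<noteq> {}" for f
  proof -
    have "\<forall>n. choquet_legal_I X (x f) (U f) (V f) n"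
      using legal by blast
    then show ?thesis
      using win unfolding choquet_winning_II_def Let_def V_def by simp
  qed
  then have "\<exists>p. \<forall>n. p \<in> U f n" for f
    by (metis INT_E UNIV_I ex_in_conv)
  then obtain y where y: "\<And>f n. y f \<in> U f n"
    by metis
  show thesis
  proof (rule that[of y])
    have "U f 0 = topspace X" for f
      by (simp add: U_def pos_def)
    then show "range y \<subseteq> topspace X"
      using y by blast
    fix f g :: "nat \<Rightarrow> bool"
    assume "f \<noteq> g"
    \<comment> \<open>The branches part at the first bit \<open>n\<close> where they differ; up to there the plays agree.\<close>
    then obtain n where n: "f n \<noteq> g n" "\<And>i. i < n \<Longrightarrow> f i = g i"
      using exists_least_iff[of "\<lambda>n. f n \<noteq> g n"] by blast
    then have "pos f n = pos g n"
      unfolding pos_def by (intro branch_position_cong) auto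
    then have "V f n = V g n"
      by (simp add: V_eq)
    then have "y f \<in> snd (split (V f n) (f n))" "y g \<in> snd (split (V f n) (g n))"
      using y[of f "Suc n"] y[of g "Suc n"] by (simp_all add: U_def last_Suc)
    then show "{y f, y g} \<in> K0"
      using split_K0[OF V n(1)] by blast
  qed
qed

section \<open>Deleting the isolated points\<close>

text \<open>The set \<open>C\<close> collects the points of \<open>Y\<close> with a countable neighbourhood in \<open>Y\<close>. A point isolated
  in \<open>Y - C\<close> would have a neighbourhood in \<open>Y\<close> that adds only this point to a part of the countable
  set \<open>C\<close>, and so would belong to \<open>C\<close>.\<close>

lemma Lindelof_condensation_points:
  assumes "hereditarily Lindelof_space X"
  obtains C where "countable C" "no_isolated_points (subtopology X (Y - C))"
proof -
  define \<U> where "\<U> = {U. openin X U \<and> countable (U \<inter> Y)}"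
  define C where "C = \<Union>\<U> \<inter> Y"
  have "openin X U" if "U \<in> \<U>" for U
    using that by (simp add: \<U>_def)
  then obtain \<V> where \<V>: "countable \<V>" "\<V> \<subseteq> \<U>" "\<Union>\<V> = \<Union>\<U>"
    by (metis hereditarily_Lindelof_countable_subfamily[OF assms])
  have "C = (\<Union>U\<in>\<V>. U \<inter> Y)"
    using \<V>(3) by (auto simp: C_def)
  moreover have "countable (\<Union>U\<in>\<V>. U \<inter> Y)"
    using \<V>(1,2) by (intro countable_UN) (auto simp: \<U>_def)
  ultimately have C: "countable C"
    by simp
  show thesis
  proof (rule that[OF C], unfold no_isolated_points_def, intro ballI notI)
    fix x assume "x \<in> topspace (subtopology X (Y - C))"
      and "openin (subtopology X (Y - C)) {x}"
    then obtain U where U: "openin X U" "{x} = U \<inter> (Y - C)"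
      by (auto simp: openin_subtopology)
    then have "U \<inter> Y \<subseteq> insert x C"
      by blast
    then have "countable (U \<inter> Y)"
      by (rule countable_subset) (simp add: C)
    then have "U \<in> \<U>"
      using U(1) by (simp add: \<U>_def)
    then show False
      using U(2) by (auto simp: C_def)
  qed
qed

section \<open>Homogeneous sets of size continuum\<close>

lemma not_sigma_homogeneous_imp_continuum_homogeneous:
  assumes "hereditarily Lindelof_space X" and "strong_choquet X"
    and part: "open_partition X K0 K1" and "\<not> sigma_homogeneous X K1 (topspace X)"
  obtains Y where "homogeneous X K0 Y" "Y \<approx> (UNIV :: real set)"
    "no_isolated_points (subtopology X Y)"
proof -
  obtain \<sigma> where \<sigma>: "choquet_winning_II X \<sigma>"
    using assms(2) by (auto simp: strong_choquet_def)
  obtain Z where Z: "Z \<subseteq> topspace X" "Z \<noteq> {}"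
      "\<And>V. openin X V \<Longrightarrow> V \<inter> Z \<noteq> {} \<Longrightarrow> \<not> homogeneous X K1 (V \<inter> Z)"
    by (rule sigma_homogeneous_kernel[OF assms(1,4)]) blast
  obtain y :: "(nat \<Rightarrow> bool) \<Rightarrow> 'a" where
    y: "range y \<subseteq> topspace X" "\<And>f g. f \<noteq> g \<Longrightarrow> {y f, y g} \<in> K0"
    using Choquet_Cantor_scheme[OF part \<sigma> Z] by blast
  have "K0 \<subseteq> [topspace X]\<^bsup>2\<^esup>"
    using part by (auto simp: open_partition_def)
  \<comment> \<open>Members of \<open>K0\<close> have two elements, so points of different branches differ.\<close>
  then have "inj y"
    using y(2) by (intro injI) (metis doubleton_in_nsets_2 subsetD)
  have hom: "homogeneous X K0 (range y)"
    unfolding homogeneous_def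
  proof (intro conjI subsetI)
    fix e assume "e \<in> [range y]\<^bsup>2\<^esup>"
    then obtain f g where "e = {y f, y g}" "y f \<noteq> y g"
      by (elim nsets2_E rangeE) blast
    then show "e \<in> K0"
      using y(2)[of f g] by auto
  qed (use y(1) in blast)
  have "range y \<approx> (UNIV :: (nat \<Rightarrow> bool) set)"
    using \<open>inj y\<close> by (simp add: inj_on_image_eqpoll_self)
  also have "(UNIV :: (nat \<Rightarrow> bool) set) \<approx> (UNIV :: nat set set)"
    unfolding eqpoll_def
    by (intro exI[of _ Collect] bij_betwI[where g = "\<lambda>A n. n \<in> A"]) auto
  also note nat_sets_eqpoll_reals
  finally have card: "range y \<approx> (UNIV :: real set)" .
  obtain C where C: "countable C" "no_isolated_points (subtopology X (range y - C))"
    by (rule Lindelof_condensation_points[OF assms(1)])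
  have "uncountable (range y)"
    by (rule eqpoll_reals_imp_uncountable[OF card])
  then have "range y - C \<approx> (UNIV :: real set)"
    using uncountable_Diff_countable_eqpoll[OF _ C(1)] card eqpoll_trans by blast
  then show thesis
    using that[OF homogeneous_subset[OF hom] _ C(2)] by blast
qed

theorem corollary3p3:
  fixes X :: "'a topology"
  assumes "hereditarily Lindelof_space X"
    and "t1_space X"
    and "regular_space X"
    and "strong_choquet X"
  shows "OGA X \<and>
    (\<forall>K0 K1. open_partition X K0 K1 \<longrightarrow> \<not> sigma_homogeneous X K1 (topspace X) \<longrightarrow>
       (\<exists>Y. homogeneous X K0 Y \<and> Y \<approx> (UNIV :: real set) \<and>
            no_isolated_points (subtopology X Y)))"
proof -
  have continuum: "\<exists>Y. homogeneous X K0 Y \<and> Y \<approx> (UNIV :: real set) \<and>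
      no_isolated_points (subtopology X Y)"
    if "open_partition X K0 K1" "\<not> sigma_homogeneous X K1 (topspace X)" for K0 K1
    using not_sigma_homogeneous_imp_continuum_homogeneous[OF assms(1,4) that] by blast
  have "OGA X"
    unfolding OGA_def
  proof (intro allI impI)
    fix K0 K1 assume part: "open_partition X K0 K1"
    show "(\<exists>Y. homogeneous X K0 Y \<and> uncountable Y) \<or>
        (\<exists>\<H>. countable \<H> \<and> (\<forall>H\<in>\<H>. homogeneous X K1 H) \<and> \<Union>\<H> = topspace X)"
    proof (cases "sigma_homogeneous X K1 (topspace X)")
      case True
      then obtain \<H> where \<H>: "countable \<H>" "\<forall>H\<in>\<H>. homogeneous X K1 H" "topspace X \<subseteq> \<Union>\<H>"
        by (auto simp: sigma_homogeneous_def)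
      then have "\<Union>\<H> = topspace X"
        by (auto simp: homogeneous_def)
      with \<H> show ?thesis
        by blast
    next
      case False
      then obtain Y where "homogeneous X K0 Y" "Y \<approx> (UNIV :: real set)"
        using continuum[OF part] by blast
      then have "homogeneous X K0 Y \<and> uncountable Y"
        by (simp add: eqpoll_reals_imp_uncountable)
      then show ?thesis
        by (intro disjI1 exI)
    qed
  qed
  with continuum show ?thesis
    by blast
qed

end
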